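(* Let $I$ be a homogeneous ideal of the weighted polynomial ring $R$. Then $I$ is $T$-fixed (i.e. $\phi(I)=I$ for all $\phi\in T$) if and only if $I$ is strongly stable.
   Context: Setting: $K$ is an infinite field of characteristic $0$ and $R=K[\mathbf{X_1},\ldots,\mathbf{X_n}]$ is a polynomial ring in the groups of variables $\mathbf{X_i}=(X_{i1},\ldots,X_{il_i})$, graded by $\deg X_{ij}=q_i$ for $j=1,\ldots,l_i$, where $0<q_1<q_2<\cdots<q_n$ are integers. Let $R_{[i]}=K[\mathbf{X_1},\ldots,\mathbf{X_i}]$ (and $R_{[0]}=K$). Group $T$: the group of graded $K$-algebra automorphisms $\phi$ of $R$ of the form $\phi(X_{ij})=\sum_{h\le j}a^i_{jh}X_{ih}+\psi_{ij}$ with $a^i_{jh}\in K$, $a^i_{jj}\neq 0$, and $\psi_{ij}\in R_{[i-1]}$ homogeneous of degree $q_i$ (possibly zero). Strongly stable: an ideal $I$ is (strongly) stable if it is a monomial ideal and for every monomial $u\in I$ and every variable $X_{ij}$ dividing $u$ one has $\frac{X_{ih}u}{X_{ij}}\in I$ for every $h<j$, and $\frac{vu}{X_{ij}}\in I$ for all monomials $v\in R_{[i-1]}$ of degree $q_i$. *)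

theory Defs
  imports Complex_Main "HOL-Library.Poly_Mapping" "HOL-Algebra.QuotRing"
begin

text \<open>
  The variable \<open>X_{ij}\<close> is the index pair \<open>(i, j)\<close>, with \<open>1 \<le> i \<le> n\<close> and \<open>1 \<le> j \<le> l i\<close> as in the
  informal notation.  A monomial is represented by its exponent vector, and a polynomial by its
  finitely supported coefficient function, whose library multiplication is convolution.
\<close>

type_synonym mon = "(nat \<times> nat) \<Rightarrow>\<^sub>0 nat"
type_synonym 'k mpoly = "mon \<Rightarrow>\<^sub>0 'k"

definition vars :: "(nat \<Rightarrow> nat) \<Rightarrow> nat \<Rightarrow> (nat \<times> nat) set" where
  "vars l k = {(i, j). i \<in> {1..k} \<and> j \<in> {1..l i}}"

definition mons :: "(nat \<Rightarrow> nat) \<Rightarrow> nat \<Rightarrow> mon set" where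
  "mons l k = {m. Poly_Mapping.keys m \<subseteq> vars l k}"

definition monomial :: "mon \<Rightarrow> 'k::field_char_0 mpoly" where
  "monomial m = Poly_Mapping.single m 1"

definition const :: "'k::field_char_0 \<Rightarrow> 'k mpoly" where
  "const c = Poly_Mapping.single 0 c"

text \<open>The exponent vector of \<open>X_{ij}\<close>.\<close>

definition xvar :: "nat \<Rightarrow> nat \<Rightarrow> mon" where
  "xvar i j = Poly_Mapping.single (i, j) 1"

text \<open>\<open>mpoly_ring l k\<close> is \<open>R_{[k]}\<close>, the polynomial ring in the first \<open>k\<close> groups of variables; in
  particular \<open>R = mpoly_ring l n\<close> and \<open>R_{[0]}\<close> consists of the constants.\<close>

definition mpoly_ring :: "(nat \<Rightarrow> nat) \<Rightarrow> nat \<Rightarrow> 'k::field_char_0 mpoly ring" where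
  "mpoly_ring l k =
    \<lparr>carrier = {f. Poly_Mapping.keys f \<subseteq> mons l k}, mult = (*), one = 1, zero = 0, add = (+)\<rparr>"

definition mdeg :: "(nat \<Rightarrow> nat) \<Rightarrow> mon \<Rightarrow> nat" where
  "mdeg q m = (\<Sum>(i, j)\<in>Poly_Mapping.keys m. q i * Poly_Mapping.lookup m (i, j))"

text \<open>The zero polynomial is homogeneous of every degree.\<close>

definition homogeneous :: "(nat \<Rightarrow> nat) \<Rightarrow> nat \<Rightarrow> 'k::field_char_0 mpoly \<Rightarrow> bool" where
  "homogeneous q d f \<longleftrightarrow> (\<forall>m\<in>Poly_Mapping.keys f. mdeg q m = d)"

definition homogeneous_ideal ::
  "nat \<Rightarrow> (nat \<Rightarrow> nat) \<Rightarrow> (nat \<Rightarrow> nat) \<Rightarrow> 'k::field_char_0 mpoly set \<Rightarrow> bool" where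
  "homogeneous_ideal n l q I \<longleftrightarrow>
    ideal I (mpoly_ring l n) \<and>
    (\<exists>S \<subseteq> {f \<in> carrier (mpoly_ring l n). \<exists>d. homogeneous q d f}. I = Idl\<^bsub>mpoly_ring l n\<^esub> S)"

definition monomial_ideal ::
  "nat \<Rightarrow> (nat \<Rightarrow> nat) \<Rightarrow> 'k::field_char_0 mpoly set \<Rightarrow> bool" where
  "monomial_ideal n l I \<longleftrightarrow>
    ideal I (mpoly_ring l n) \<and> (\<exists>M \<subseteq> mons l n. I = Idl\<^bsub>mpoly_ring l n\<^esub> (monomial ` M))"

text \<open>The maps in \<open>T\<close> are total functions on the type of polynomials, but only their values on \<open>R\<close>
  are constrained; values elsewhere are irrelevant.  The conditions are, in order: ring automorphism
  of \<open>R\<close>, \<open>K\<close>-linearity, gradedness, and the prescribed form on the variables.\<close>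

definition T_group ::
  "nat \<Rightarrow> (nat \<Rightarrow> nat) \<Rightarrow> (nat \<Rightarrow> nat) \<Rightarrow> ('k::field_char_0 mpoly \<Rightarrow> 'k mpoly) set" where
  "T_group n l q = {\<phi>.
    \<phi> \<in> ring_iso (mpoly_ring l n) (mpoly_ring l n) \<and>
    (\<forall>c. \<phi> (const c) = const c) \<and>
    (\<forall>d. \<forall>f\<in>carrier (mpoly_ring l n). homogeneous q d f \<longrightarrow> homogeneous q d (\<phi> f)) \<and>
    (\<exists>(a :: nat \<Rightarrow> nat \<Rightarrow> nat \<Rightarrow> 'k) (\<psi> :: nat \<Rightarrow> nat \<Rightarrow> 'k mpoly).
      \<forall>i\<in>{1..n}. \<forall>j\<in>{1..l i}.
        a i j j \<noteq> 0 \<and>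
        \<psi> i j \<in> carrier (mpoly_ring l (i - 1)) \<and> homogeneous q (q i) (\<psi> i j) \<and>
        \<phi> (monomial (xvar i j)) =
          (\<Sum>h = 1..j. const (a i j h) * monomial (xvar i h)) + \<psi> i j)}"

definition T_fixed ::
  "nat \<Rightarrow> (nat \<Rightarrow> nat) \<Rightarrow> (nat \<Rightarrow> nat) \<Rightarrow> 'k::field_char_0 mpoly set \<Rightarrow> bool" where
  "T_fixed n l q I \<longleftrightarrow> (\<forall>\<phi>\<in>T_group n l q. \<phi> ` I = I)"

text \<open>Monomials are multiplied and divided by adding and subtracting exponent vectors.  The truncated
  subtraction is exact here, because \<open>X_{ij}\<close> divides \<open>u\<close>.\<close>

definition strongly_stable ::
  "nat \<Rightarrow> (nat \<Rightarrow> nat) \<Rightarrow> (nat \<Rightarrow> nat) \<Rightarrow> 'k::field_char_0 mpoly set \<Rightarrow> bool" where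
  "strongly_stable n l q I \<longleftrightarrow>
    monomial_ideal n l I \<and>
    (\<forall>u\<in>mons l n. monomial u \<in> I \<longrightarrow>
      (\<forall>i\<in>{1..n}. \<forall>j\<in>{1..l i}. 0 < Poly_Mapping.lookup u (i, j) \<longrightarrow>
        (\<forall>h\<in>{1..<j}. monomial ((xvar i h + u) - xvar i j) \<in> I) \<and>
        (\<forall>v\<in>mons l (i - 1). mdeg q v = q i \<longrightarrow> monomial ((v + u) - xvar i j) \<in> I)))"

lemma mpoly_ring_simps [simp]:
  "carrier (mpoly_ring l k) = {f. Poly_Mapping.keys f \<subseteq> mons l k}"
  "mult (mpoly_ring l k) = (*)" "one (mpoly_ring l k) = 1"
  "zero (mpoly_ring l k) = 0" "add (mpoly_ring l k) = (+)"
  by (simp_all add: mpoly_ring_def)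

lemma mons_add: "u \<in> mons l k \<Longrightarrow> v \<in> mons l k \<Longrightarrow> u + v \<in> mons l k"
  using Poly_Mapping.keys_add[of u v] by (auto simp: mons_def)

lemma mpoly_ring_cring: "cring (mpoly_ring l k :: 'k::field_char_0 mpoly ring)"
proof (rule cringI)
  show "abelian_group (mpoly_ring l k :: 'k mpoly ring)"
  proof (rule abelian_groupI)
    fix f :: "'k mpoly" assume "f \<in> carrier (mpoly_ring l k)"
    then show "\<exists>g\<in>carrier (mpoly_ring l k). g \<oplus>\<^bsub>mpoly_ring l k\<^esub> f = \<zero>\<^bsub>mpoly_ring l k\<^esub>"
      by (auto intro!: exI[of _ "- f"])
  qed (use Poly_Mapping.keys_add in \<open>fastforce simp: algebra_simps\<close>)+
  show "comm_monoid (mpoly_ring l k :: 'k mpoly ring)"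
  proof (rule comm_monoidI)
    fix f g :: "'k mpoly"
    assume "f \<in> carrier (mpoly_ring l k)" "g \<in> carrier (mpoly_ring l k)"
    then show "f \<otimes>\<^bsub>mpoly_ring l k\<^esub> g \<in> carrier (mpoly_ring l k)"
      using Poly_Mapping.keys_mult[of f g] by (fastforce intro: mons_add)
  qed (auto simp: mons_def algebra_simps)
qed (auto simp: algebra_simps)

end

theory Submission
  imports Defs
begin

text \<open>
  A linear span of monomials is the set of polynomials whose support lies in a given set of
  monomials, and everything below is phrased through supports. Write \<open>A\<close> for the set consisting of
  \<open>X\<^sub>i\<^sub>j\<close>, of the \<open>X\<^sub>i\<^sub>h\<close> with \<open>h < j\<close>, and of the monomials of degree \<open>q\<^sub>i\<close> in \<open>R\<^bsub>[i-1]\<^esub>\<close>. The maps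
  in \<open>T\<close> send \<open>X\<^sub>i\<^sub>j\<close> into the span of \<open>A\<close>, and strong stability says that \<open>I\<close> is a monomial ideal in which a factor \<open>X\<^sub>i\<^sub>j\<close> of a
  monomial of \<open>I\<close> may be replaced by any element of \<open>A\<close>.

  Suppose that \<open>I\<close> is strongly stable and that an endomorphism \<open>\<chi>\<close> sends each \<open>X\<^sub>i\<^sub>j\<close> into the span of
  its set \<open>A\<close>. Every monomial occurring in \<open>\<chi> u\<close> arises from \<open>u\<close> by replacing its variables one after
  the other, so \<open>u \<in> I\<close> gives \<open>\<chi> u \<in> I\<close>; this is \<open>triangular_strongly_stable\<close>. For \<open>\<phi> \<in> T\<close> it applies
  to \<open>\<phi>\<close> itself, which gives \<open>\<phi> ` I \<subseteq> I\<close>, and also to the inverse of \<open>\<phi>\<close>, whose triangular shape is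
  \<open>T_group_inverse_triangular\<close>. Hence \<open>\<phi> ` I = I\<close>.

  Conversely, let \<open>I\<close> be fixed by \<open>T\<close>. The group contains the elementary automorphisms, which replace a
  single variable \<open>X\<^sub>i\<^sub>j\<close> by \<open>t X\<^sub>i\<^sub>j + p\<close> with \<open>t \<noteq> 0\<close> and \<open>p\<close> in the span of \<open>A\<close> without \<open>X\<^sub>i\<^sub>j\<close>. With
  \<open>t = 2\<close> and \<open>p = 0\<close> the monomials are eigenvectors with eigenvalues \<open>2\<^sup>e\<close>, where \<open>e\<close> is the exponent
  of \<open>X\<^sub>i\<^sub>j\<close>; in characteristic \<open>0\<close> these separate the exponents, and so \<open>I\<close> contains every monomial
  that occurs in one of its elements (\<open>T_fixed_monomials\<close>). With \<open>t = 1\<close> and a monomial \<open>p = v\<close>, and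
  for \<open>w\<close> free of \<open>X\<^sub>i\<^sub>j\<close>, the image of \<open>X\<^sub>i\<^sub>j\<^sup>a w\<close> contains \<open>v X\<^sub>i\<^sub>j\<^sup>a\<^sup>-\<^sup>1 w\<close> with coefficient \<open>a\<close>, which is nonzero in characteristic
  \<open>0\<close>, so that this replacement stays in \<open>I\<close> (\<open>T_fixed_lower\<close>).
\<close>

section \<open>Monomials and polynomials\<close>

lemma mdeg_add: "mdeg q (u + v) = mdeg q u + mdeg q v"
  unfolding mdeg_def case_prod_beta prod.collapse
  by (rule setsum_keys_plus_distrib) (simp_all add: algebra_simps)

lemma mdeg_xvar [simp]: "mdeg q (xvar i j) = q i"
  by (simp add: mdeg_def xvar_def)

lemma mdeg_zero [simp]: "mdeg q 0 = 0"
  by (simp add: mdeg_def)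

lemma zero_in_mons [simp]: "0 \<in> mons l k"
  by (simp add: mons_def)

lemma xvar_in_mons_iff [simp]: "xvar i j \<in> mons l k \<longleftrightarrow> (i, j) \<in> vars l k"
  by (simp add: mons_def xvar_def)

lemma vars_mono: "k \<le> k' \<Longrightarrow> vars l k \<subseteq> vars l k'"
  by (auto simp: vars_def)

lemma mons_mono: "k \<le> k' \<Longrightarrow> mons l k \<subseteq> mons l k'"
  using vars_mono unfolding mons_def by blast

lemma lookup_xvar: "Poly_Mapping.lookup (xvar i j) x = (if x = (i, j) then 1 else 0)"
  by (simp add: xvar_def lookup_single when_def)

lemma xvar_eq_iff [simp]: "xvar i j = xvar i' j' \<longleftrightarrow> i = i' \<and> j = j'"
  by (metis lookup_xvar prod.inject zero_neq_one)

lemma xvar_add_minus: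
  assumes "0 < Poly_Mapping.lookup u (i, j)"
  shows "xvar i j + (u - xvar i j) = u"
  using assms by (intro poly_mapping_eqI) (auto simp: lookup_add lookup_minus lookup_xvar)

lemma minus_in_mons: "u \<in> mons l k \<Longrightarrow> u - v \<in> mons l k"
  by (auto simp: mons_def lookup_minus in_keys_iff subset_iff)

lemma mon_induct [consumes 1, case_names zero add]:
  assumes "u \<in> mons l k"
    and "P 0"
    and step: "\<And>i j u. (i, j) \<in> vars l k \<Longrightarrow> u \<in> mons l k \<Longrightarrow> P u \<Longrightarrow> P (xvar i j + u)"
  shows "P u"
  using assms(1)
proof (induction "mdeg (\<lambda>_. 1) u" arbitrary: u rule: less_induct)
  case less
  show ?case
  proof (cases "u = 0")
    case True
    then show ?thesis using assms(2) by simp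
  next
    case False
    then have "\<exists>x. x \<in> Poly_Mapping.keys u"
      by (metis all_not_in_conv keys_eq_empty)
    then obtain i j where ij: "(i, j) \<in> Poly_Mapping.keys u"
      by auto
    let ?w = "u - xvar i j"
    have u: "xvar i j + ?w = u"
      using ij by (intro xvar_add_minus) (simp add: in_keys_iff)
    have "mdeg (\<lambda>_. 1) ?w < mdeg (\<lambda>_. 1) u"
      using mdeg_add[of "\<lambda>_. 1" "xvar i j" ?w] by (simp add: u)
    moreover have "?w \<in> mons l k"
      using less.prems by (rule minus_in_mons)
    ultimately have "P ?w"
      using less.hyps by blast
    moreover have "(i, j) \<in> vars l k"
      using ij less.prems by (auto simp: mons_def)
    ultimately show ?thesis
      using step[of i j ?w] \<open>?w \<in> mons l k\<close> by (simp add: u)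
  qed
qed

lemma monomial_add: "monomial (u + v) = monomial u * monomial v"
  by (simp add: monomial_def mult_single)

lemma monomial_zero [simp]: "monomial 0 = 1"
  by (simp add: monomial_def)

lemma keys_monomial [simp]: "Poly_Mapping.keys (monomial u) = {u}"
  by (simp add: monomial_def)

lemma const_mult: "const (a * b) = const a * const b"
  by (simp add: const_def mult_single)

lemma const_one [simp]: "const 1 = 1"
  by (simp add: const_def)

lemma const_zero [simp]: "const 0 = 0"
  by (simp add: const_def)

lemma const_monomial: "const c * monomial u = Poly_Mapping.single u c"
  by (simp add: const_def monomial_def mult_single)

lemma const_add: "const (a + b) = const a + const b"
  by (simp add: const_def single_add)

lemma monomial_sum: "finite A \<Longrightarrow> monomial (sum f A) = (\<Prod>x\<in>A. monomial (f x))"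
  by (induction A rule: finite_induct) (simp_all add: monomial_add)

lemma monomial_power: "monomial u ^ e = monomial (\<Sum>_<e. u)"
  by (simp add: monomial_sum)

lemma monomial_single_power: "monomial (Poly_Mapping.single x 1) ^ e = monomial (Poly_Mapping.single x e)"
  by (induction e) (simp_all flip: monomial_add single_add)

lemma keys_const: "Poly_Mapping.keys (const c) \<subseteq> {0}"
  by (simp add: const_def)

lemma poly_expand:
  "f = (\<Sum>m\<in>Poly_Mapping.keys f. const (Poly_Mapping.lookup f m) * monomial m)"
  by (rule poly_mapping_eqI)
    (simp add: lookup_sum const_monomial lookup_single when_def in_keys_iff)

lemma lookup_const_mult:
  "Poly_Mapping.lookup (const c * f) m = c * Poly_Mapping.lookup f m"
  unfolding const_def mult_map_scale_conv_mult[symmetric] 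
  by (simp add: Poly_Mapping.map.rep_eq when_def)

lemma keys_const_mult_subset: "Poly_Mapping.keys (const c * f) \<subseteq> Poly_Mapping.keys f"
  by (auto simp: in_keys_iff lookup_const_mult)

lemma keys_const_mult: "c \<noteq> 0 \<Longrightarrow> Poly_Mapping.keys (const c * f) = Poly_Mapping.keys f"
  by (auto simp: in_keys_iff lookup_const_mult)

text \<open>
  The ring \<open>R\<^bsub>[k]\<^esub>\<close> is generated as a ring by the constants and the variables.
\<close>

lemma poly_in_carrier_induct [consumes 1, case_names const monomial add mult]:
  assumes "Poly_Mapping.keys f \<subseteq> mons l k"
    and const: "\<And>c. P (const c)"
    and var: "\<And>i j. (i, j) \<in> vars l k \<Longrightarrow> P (monomial (xvar i j))"
    and add: "\<And>f g. P f \<Longrightarrow> P g \<Longrightarrow> P (f + g)"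
    and mult: "\<And>f g. P f \<Longrightarrow> P g \<Longrightarrow> P (f * g)"
  shows "P f"
proof -
  have mon: "P (monomial m)" if "m \<in> mons l k" for m
    using that
  proof (induction m rule: mon_induct)
    case zero
    then show ?case using const[of 1] by simp
  next
    case (add i j u)
    then show ?case by (simp add: monomial_add var mult)
  qed
  have "P (\<Sum>m\<in>A. const (Poly_Mapping.lookup f m) * monomial m)"
    if "finite A" "A \<subseteq> mons l k" for A
    using that
  proof (induction A)
    case empty
    then show ?case using const[of 0] by simp
  next
    case (insert m A)
    then show ?case by (simp add: mon const add mult)
  qed
  from this[of "Poly_Mapping.keys f"] assms(1) show ?thesis
    by (simp flip: poly_expand)
qed

section \<open>Monomial ideals\<close>

lemma ideal_subset_carrier:
  "ideal I (mpoly_ring l n) \<Longrightarrow> f \<in> I \<Longrightarrow> Poly_Mapping.keys f \<subseteq> mons l n"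
  using additive_subgroup.a_Hcarr ideal.axioms(1) by fastforce

lemma ideal_sum:
  assumes "ideal I (mpoly_ring l n)" "\<And>x. x \<in> A \<Longrightarrow> f x \<in> I"
  shows "sum f A \<in> I"
  using assms(2)
  by (induction A rule: infinite_finite_induct)
    (use assms(1) additive_subgroup.zero_closed additive_subgroup.a_closed ideal.axioms(1) in fastforce)+

lemma ideal_mult:
  assumes "ideal I (mpoly_ring l n)" "f \<in> I" "Poly_Mapping.keys g \<subseteq> mons l n"
  shows "g * f \<in> I"
  using ideal.I_l_closed[OF assms(1,2), of g] assms(3) by simp

text \<open>
  One of the two directions in which a monomial ideal is determined by its monomials; it holds for
  every ideal because an ideal is closed under linear combinations.
\<close>

lemma ideal_contains_if_monomials:
  assumes "ideal I (mpoly_ring l n)" "\<And>m. m \<in> Poly_Mapping.keys f \<Longrightarrow> monomial m \<in> I"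
  shows "f \<in> I"
proof (subst poly_expand, rule ideal_sum[OF assms(1)])
  fix m assume "m \<in> Poly_Mapping.keys f"
  moreover have "Poly_Mapping.keys (const c) \<subseteq> mons l n" for c :: 'a
    using keys_const[of c] by auto
  ultimately show "const (Poly_Mapping.lookup f m) * monomial m \<in> I"
    using assms by (intro ideal_mult)
qed

text \<open>
  For a generated ideal, the point is that the polynomials all of whose monomials lie in the ideal
  form an ideal again, which contains the generators.
\<close>

lemma monomial_ideal_iff:
  assumes "ideal I (mpoly_ring l n)"
  shows "monomial_ideal n l I \<longleftrightarrow> (\<forall>f\<in>I. \<forall>m\<in>Poly_Mapping.keys f. monomial m \<in> I)"
proof
  interpret cring "mpoly_ring l n :: 'a mpoly ring" by (rule mpoly_ring_cring)
  assume "monomial_ideal n l I"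
  then obtain M where M: "M \<subseteq> mons l n" "I = Idl\<^bsub>mpoly_ring l n\<^esub> (monomial ` M)"
    by (auto simp: monomial_ideal_def)
  define J where
    "J = {f :: 'a mpoly. Poly_Mapping.keys f \<subseteq> mons l n \<and> (\<forall>m\<in>Poly_Mapping.keys f. monomial m \<in> I)}"
  have mult: "g * f \<in> J" if "f \<in> J" "Poly_Mapping.keys g \<subseteq> mons l n" for f g
  proof -
    have "p \<in> mons l n \<and> monomial p \<in> I" if p: "p \<in> Poly_Mapping.keys (g * f)" for p
    proof -
      obtain a b where "p = a + b" "a \<in> Poly_Mapping.keys g" "b \<in> Poly_Mapping.keys f"
        using keys_mult[of g f] p by blast
      with \<open>f \<in> J\<close> \<open>Poly_Mapping.keys g \<subseteq> mons l n\<close> show ?thesis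
        by (auto simp: J_def monomial_add intro!: mons_add ideal_mult[OF assms])
    qed
    then show ?thesis by (auto simp: J_def)
  qed
  have "ideal J (mpoly_ring l n)"
  proof (rule idealI)
    show "subgroup J (add_monoid (mpoly_ring l n))"
    proof (rule add.subgroupI)
      fix f g assume "f \<in> J" "g \<in> J"
      then show "f \<oplus>\<^bsub>mpoly_ring l n\<^esub> g \<in> J"
        using keys_add[of f g] by (auto simp: J_def)
    next
      fix f assume f: "f \<in> J"
      have "\<ominus>\<^bsub>mpoly_ring l n\<^esub> f = - f"
        using f by (intro minus_equality) (auto simp: J_def)
      with f show "\<ominus>\<^bsub>mpoly_ring l n\<^esub> f \<in> J" by (simp add: J_def)
    qed (auto simp: J_def intro!: exI[of _ 0])
  qed (use mult in \<open>auto simp: mult.commute ring_axioms\<close>)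
  moreover have "monomial ` M \<subseteq> J"
  proof -
    have "monomial ` M \<subseteq> I"
      unfolding M(2) using M(1) by (intro genideal_self) auto
    then show ?thesis using M(1) by (auto simp: J_def)
  qed
  ultimately have "I \<subseteq> J"
    unfolding M(2) by (rule genideal_minimal)
  then show "\<forall>f\<in>I. \<forall>m\<in>Poly_Mapping.keys f. monomial m \<in> I"
    by (auto simp: J_def)
next
  interpret cring "mpoly_ring l n :: 'a mpoly ring" by (rule mpoly_ring_cring)
  assume *: "\<forall>f\<in>I. \<forall>m\<in>Poly_Mapping.keys f. monomial m \<in> I"
  define M where "M = {m \<in> mons l n. monomial m \<in> I}"
  have sub: "monomial ` M \<subseteq> carrier (mpoly_ring l n :: 'a mpoly ring)"
    by (auto simp: M_def)
  have "I \<subseteq> Idl\<^bsub>mpoly_ring l n\<^esub> (monomial ` M)"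
  proof
    fix f assume f: "f \<in> I"
    show "f \<in> Idl\<^bsub>mpoly_ring l n\<^esub> (monomial ` M)"
    proof (rule ideal_contains_if_monomials[OF genideal_ideal[OF sub]])
      fix m assume "m \<in> Poly_Mapping.keys f"
      then have "m \<in> M"
        using * f ideal_subset_carrier[OF assms f] by (auto simp: M_def)
      then show "(monomial m :: 'a mpoly) \<in> Idl\<^bsub>mpoly_ring l n\<^esub> (monomial ` M)"
        using genideal_self[OF sub] by blast
    qed
  qed
  moreover have "Idl\<^bsub>mpoly_ring l n\<^esub> (monomial ` M) \<subseteq> I"
    by (rule genideal_minimal[OF assms]) (auto simp: M_def)
  ultimately have "I = Idl\<^bsub>mpoly_ring l n\<^esub> (monomial ` M)"
    by (rule equalityI)
  moreover have "M \<subseteq> mons l n"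
    by (simp add: M_def)
  ultimately show "monomial_ideal n l I"
    unfolding monomial_ideal_def using assms by blast
qed

section \<open>Algebra endomorphisms\<close>

definition alg_endo ::
  "nat \<Rightarrow> (nat \<Rightarrow> nat) \<Rightarrow> ('k::field_char_0 mpoly \<Rightarrow> 'k mpoly) \<Rightarrow> bool" where
  "alg_endo n l \<chi> \<longleftrightarrow>
    \<chi> \<in> ring_hom (mpoly_ring l n) (mpoly_ring l n) \<and> (\<forall>c. \<chi> (const c) = const c)"

lemma alg_endo_const: "alg_endo n l \<chi> \<Longrightarrow> \<chi> (const c) = const c"
  by (simp add: alg_endo_def)

lemma alg_endo_one: "alg_endo n l \<chi> \<Longrightarrow> \<chi> 1 = 1"
  using alg_endo_const[of n l \<chi> 1] by simp

lemma alg_endo_zero: "alg_endo n l \<chi> \<Longrightarrow> \<chi> 0 = 0"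
  using alg_endo_const[of n l \<chi> 0] by simp

lemma alg_endo_add:
  assumes "alg_endo n l \<chi>" "Poly_Mapping.keys f \<subseteq> mons l n" "Poly_Mapping.keys g \<subseteq> mons l n"
  shows "\<chi> (f + g) = \<chi> f + \<chi> g"
  using assms by (auto simp: alg_endo_def ring_hom_def)

lemma alg_endo_mult:
  assumes "alg_endo n l \<chi>" "Poly_Mapping.keys f \<subseteq> mons l n" "Poly_Mapping.keys g \<subseteq> mons l n"
  shows "\<chi> (f * g) = \<chi> f * \<chi> g"
  using assms by (auto simp: alg_endo_def ring_hom_def)

lemma alg_endo_sum:
  assumes "alg_endo n l \<chi>" "\<And>x. x \<in> A \<Longrightarrow> Poly_Mapping.keys (f x) \<subseteq> mons l n"
  shows "\<chi> (sum f A) = (\<Sum>x\<in>A. \<chi> (f x))"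
  using assms(2)
proof (induction A rule: infinite_finite_induct)
  case (insert x A)
  moreover have "Poly_Mapping.keys (sum f A) \<subseteq> mons l n"
    using keys_sum[of f A] insert.prems by blast
  ultimately show ?case by (simp add: alg_endo_add[OF assms(1)])
qed (simp_all add: alg_endo_zero[OF assms(1)])

lemma alg_endo_const_mult:
  assumes "alg_endo n l \<chi>" "Poly_Mapping.keys f \<subseteq> mons l n"
  shows "\<chi> (const c * f) = const c * \<chi> f"
proof -
  have "Poly_Mapping.keys (const c) \<subseteq> mons l n"
    using keys_const[of c] by auto
  then show ?thesis
    using assms by (simp add: alg_endo_mult alg_endo_const)
qed

text \<open>
  By linearity, an estimate for the supports of the images of monomials suffices.
\<close>

lemma keys_alg_endo:
  assumes "alg_endo n l \<chi>" "Poly_Mapping.keys f \<subseteq> mons l n"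
  shows "Poly_Mapping.keys (\<chi> f) \<subseteq> (\<Union>m\<in>Poly_Mapping.keys f. Poly_Mapping.keys (\<chi> (monomial m)))"
proof -
  let ?t = "\<lambda>m. const (Poly_Mapping.lookup f m) * monomial m"
  have "\<chi> f = \<chi> (\<Sum>m\<in>Poly_Mapping.keys f. ?t m)"
    by (simp flip: poly_expand)
  also have "\<dots> = (\<Sum>m\<in>Poly_Mapping.keys f. \<chi> (?t m))"
    using assms(2) keys_const_mult_subset
    by (intro alg_endo_sum[OF assms(1)]) fastforce
  also have "\<dots> = (\<Sum>m\<in>Poly_Mapping.keys f. const (Poly_Mapping.lookup f m) * \<chi> (monomial m))"
    using assms by (intro sum.cong alg_endo_const_mult) auto
  finally show ?thesis
    using keys_sum keys_const_mult_subset by fastforce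
qed

lemma alg_endo_monomial_keys:
  assumes "alg_endo n l \<chi>" "k \<le> n" "m \<in> mons l k"
    and "\<And>i j. (i, j) \<in> vars l k \<Longrightarrow>
      Poly_Mapping.keys (\<chi> (monomial (xvar i j))) \<subseteq> {v \<in> mons l k. mdeg q v = q i}"
  shows "Poly_Mapping.keys (\<chi> (monomial m)) \<subseteq> {v \<in> mons l k. mdeg q v = mdeg q m}"
  using assms(3)
proof (induction m rule: mon_induct)
  case zero
  then show ?case by (simp add: alg_endo_one[OF assms(1)])
next
  case (add i j u)
  have "xvar i j \<in> mons l n" "u \<in> mons l n"
    using add.hyps mons_mono[OF assms(2)] vars_mono[OF assms(2)] by auto
  then have "\<chi> (monomial (xvar i j + u)) = \<chi> (monomial (xvar i j)) * \<chi> (monomial u)"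
    by (simp add: monomial_add alg_endo_mult[OF assms(1)])
  moreover have "a + b \<in> {v \<in> mons l k. mdeg q v = mdeg q (xvar i j + u)}"
    if "a \<in> Poly_Mapping.keys (\<chi> (monomial (xvar i j)))"
      "b \<in> Poly_Mapping.keys (\<chi> (monomial u))" for a b
  proof -
    have "a \<in> {v \<in> mons l k. mdeg q v = q i}" "b \<in> {v \<in> mons l k. mdeg q v = mdeg q u}"
      using that assms(4)[OF add.hyps(1)] add.IH by blast+
    then show ?thesis by (simp add: mdeg_add mons_add)
  qed
  ultimately show ?case
    using keys_mult[of "\<chi> (monomial (xvar i j))" "\<chi> (monomial u)"] by auto
qed

text \<open>
  An endomorphism is graded and preserves \<open>R\<^bsub>[k]\<^esub>\<close> as soon as it does so on the variables. This gives
  the gradedness of elementary automorphisms, and it controls the image of the lower-order part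
  \<open>\<psi>\<close> under the inverse of an element of \<open>T\<close>.
\<close>

lemma alg_endo_graded:
  assumes "alg_endo n l \<chi>" "k \<le> n" 
    and "\<And>i j. (i, j) \<in> vars l k \<Longrightarrow>
      Poly_Mapping.keys (\<chi> (monomial (xvar i j))) \<subseteq> {v \<in> mons l k. mdeg q v = q i}"
    and "Poly_Mapping.keys f \<subseteq> mons l k" "homogeneous q d f"
  shows "Poly_Mapping.keys (\<chi> f) \<subseteq> {v \<in> mons l k. mdeg q v = d}"
proof -
  have "Poly_Mapping.keys (\<chi> (monomial m)) \<subseteq> {v \<in> mons l k. mdeg q v = d}"
    if "m \<in> Poly_Mapping.keys f" for m
    using that alg_endo_monomial_keys[OF assms(1,2) _ assms(3), of m] assms(4,5)
    by (auto simp: homogeneous_def)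
  moreover have "Poly_Mapping.keys f \<subseteq> mons l n"
    using assms(2,4) mons_mono by blast
  ultimately show ?thesis
    using keys_alg_endo[OF assms(1)] by blast
qed

section \<open>Triangular endomorphisms\<close>

text \<open>
  The monomials, other than \<open>X\<^sub>i\<^sub>j\<close> itself, that may occur in \<open>\<phi> X\<^sub>i\<^sub>j\<close> for \<open>\<phi> \<in> T\<close>; at the same time,
  the replacements of a factor \<open>X\<^sub>i\<^sub>j\<close> that strong stability allows.
\<close>

definition lower_mons :: "(nat \<Rightarrow> nat) \<Rightarrow> (nat \<Rightarrow> nat) \<Rightarrow> nat \<Rightarrow> nat \<Rightarrow> mon set" where
  "lower_mons l q i j = xvar i ` {1..<j} \<union> {v \<in> mons l (i - 1). mdeg q v = q i}"

definition triangular ::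
  "nat \<Rightarrow> (nat \<Rightarrow> nat) \<Rightarrow> (nat \<Rightarrow> nat) \<Rightarrow> ('k::field_char_0 mpoly \<Rightarrow> 'k mpoly) \<Rightarrow> bool" where
  "triangular n l q \<chi> \<longleftrightarrow> (\<forall>i j. (i, j) \<in> vars l n \<longrightarrow>
    Poly_Mapping.keys (\<chi> (monomial (xvar i j))) \<subseteq> insert (xvar i j) (lower_mons l q i j))"

lemma lower_mons_subset:
  assumes "(i, j) \<in> vars l k"
  shows "lower_mons l q i j \<subseteq> {v \<in> mons l k. mdeg q v = q i}"
proof -
  have "mons l (i - 1) \<subseteq> mons l k"
    using assms by (intro mons_mono) (auto simp: vars_def)
  then show ?thesis
    using assms by (auto simp: lower_mons_def vars_def)
qed

text \<open>
  None of these replacements involves \<open>X\<^sub>i\<^sub>j\<close>. An elementary automorphism therefore fixes the polynomial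
  that it adds to \<open>X\<^sub>i\<^sub>j\<close>, and each term of a binomial expansion can be recognised by its exponent of
  \<open>X\<^sub>i\<^sub>j\<close>.
\<close>

lemma xvar_notin_lower_mons:
  assumes "(i, j) \<in> vars l k" "v \<in> lower_mons l q i j"
  shows "Poly_Mapping.lookup v (i, j) = 0"
proof -
  have "(i, j) \<notin> vars l (i - 1)"
    using assms(1) by (auto simp: vars_def)
  then show ?thesis
    using assms(2) by (auto simp: lower_mons_def lookup_xvar mons_def in_keys_iff subset_iff)
qed

lemma triangular_homogeneous_keys:
  assumes "triangular n l q \<chi>" "k \<le> n" "(i, j) \<in> vars l k"
  shows "Poly_Mapping.keys (\<chi> (monomial (xvar i j))) \<subseteq> {v \<in> mons l k. mdeg q v = q i}"
proof -
  have "(i, j) \<in> vars l n" using assms vars_mono by blast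
  with assms lower_mons_subset[OF assms(3), of q] show ?thesis
    by (fastforce simp: triangular_def)
qed

text \<open>
  Strong stability with the factor \<open>X\<^sub>i\<^sub>j\<close> split off, which avoids division of monomials.
\<close>

lemma strongly_stable_lower:
  assumes "strongly_stable n l q I" "(i, j) \<in> vars l n" "v \<in> lower_mons l q i j" "w \<in> mons l n"
    and "monomial (xvar i j + w) \<in> I"
  shows "monomial (v + w) \<in> I"
proof -
  have "xvar i j + w \<in> mons l n"
    using assms by (intro mons_add) auto
  moreover have "0 < Poly_Mapping.lookup (xvar i j + w) (i, j)"
    by (simp add: lookup_add lookup_xvar)
  moreover have "v + (xvar i j + w) - xvar i j = v + w"
    by (metis add.left_commute add_diff_cancel_left')
  ultimately show ?thesis
    using assms unfolding strongly_stable_def lower_mons_def vars_def by fastforce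
qed

text \<open>
  Induction on \<open>u\<close> replaces one factor at a time. The factor \<open>w\<close> collects the replacements made so
  far: after \<open>X\<^sub>i\<^sub>j\<close> has been replaced by \<open>a\<close>, the induction hypothesis is used with \<open>w + a\<close>.
\<close>

lemma triangular_strongly_stable_monomial:
  assumes endo: "alg_endo n l \<chi>" and tri: "triangular n l q \<chi>"
    and stable: "strongly_stable n l q I"
    and u: "u \<in> mons l n" and w: "w \<in> mons l n" and I: "monomial (w + u) \<in> I"
    and p: "p \<in> Poly_Mapping.keys (\<chi> (monomial u))"
  shows "monomial (w + p) \<in> I"
  using u w I p
proof (induction u arbitrary: w p rule: mon_induct)
  case zero
  then show ?case by (simp add: alg_endo_one[OF endo])
next
  case (add i j u)
  have x: "xvar i j \<in> mons l n"
    using add.hyps by simp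
  then have "\<chi> (monomial (xvar i j + u)) = \<chi> (monomial (xvar i j)) * \<chi> (monomial u)"
    using add.hyps by (simp add: monomial_add alg_endo_mult[OF endo])
  then obtain a b where p: "p = a + b" and a: "a \<in> Poly_Mapping.keys (\<chi> (monomial (xvar i j)))"
    and b: "b \<in> Poly_Mapping.keys (\<chi> (monomial u))"
    using keys_mult[of "\<chi> (monomial (xvar i j))" "\<chi> (monomial u)"] add.prems(3) by auto
  have a_cases: "a = xvar i j \<or> a \<in> lower_mons l q i j"
    using a tri add.hyps(1) by (auto simp: triangular_def)
  have "a \<in> mons l n"
    using a triangular_homogeneous_keys[OF tri order_refl add.hyps(1)] by blast
  have "monomial (a + (w + u)) \<in> I"
    using a_cases
  proof
    assume "a = xvar i j"
    then show ?thesis using add.prems(2) by (simp add: ac_simps)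
  next
    assume "a \<in> lower_mons l q i j"
    moreover have "w + u \<in> mons l n"
      using add.prems(1) add.hyps(2) by (rule mons_add)
    moreover have "monomial (xvar i j + (w + u)) \<in> I"
      using add.prems(2) by (simp add: add.left_commute)
    ultimately show ?thesis
      by (rule strongly_stable_lower[OF stable add.hyps(1)])
  qed
  then have "monomial ((w + a) + u) \<in> I"
    by (simp add: add.commute add.left_commute)
  then have "monomial ((w + a) + b) \<in> I"
    using b by (rule add.IH[OF mons_add[OF add.prems(1) \<open>a \<in> mons l n\<close>]])
  then show ?case by (simp add: p add.assoc)
qed

lemma triangular_strongly_stable:
  assumes endo: "alg_endo n l \<chi>" and tri: "triangular n l q \<chi>"
    and stable: "strongly_stable n l q I" and f: "f \<in> I"
  shows "\<chi> f \<in> I"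
proof -
  have ideal: "ideal I (mpoly_ring l n)"
    using stable by (simp add: strongly_stable_def monomial_ideal_def)
  have f_carrier: "Poly_Mapping.keys f \<subseteq> mons l n"
    by (rule ideal_subset_carrier[OF ideal f])
  have mon: "monomial m \<in> I" if "m \<in> Poly_Mapping.keys f" for m
    using that stable f monomial_ideal_iff[OF ideal] by (simp add: strongly_stable_def)
  show ?thesis
  proof (rule ideal_contains_if_monomials[OF ideal])
    fix p assume "p \<in> Poly_Mapping.keys (\<chi> f)"
    then obtain m where m: "m \<in> Poly_Mapping.keys f" "p \<in> Poly_Mapping.keys (\<chi> (monomial m))"
      using keys_alg_endo[OF endo f_carrier] by blast
    then show "monomial p \<in> I"
      using triangular_strongly_stable_monomial[OF endo tri stable, of m 0 p] mon f_carrier by auto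
  qed
qed

section \<open>The automorphisms in \<open>T\<close>\<close>

text \<open>
  Recovers the normal form in the definition of \<open>T\<close> from the support alone: the monomials outside
  \<open>R\<^bsub>[i-1]\<^esub>\<close> are the variables \<open>X\<^sub>i\<^sub>1, \<dots>, X\<^sub>i\<^sub>j\<close>, and subtracting them with their coefficients leaves the
  part \<open>\<psi>\<close>.
\<close>

lemma keys_minus_linear_part:
  assumes x: "(i, j) \<in> vars l k"
    and f: "Poly_Mapping.keys f \<subseteq> insert (xvar i j) (lower_mons l q i j)"
  shows "Poly_Mapping.keys
      (f - (\<Sum>h = 1..j. const (Poly_Mapping.lookup f (xvar i h)) * monomial (xvar i h)))
    \<subseteq> {v \<in> mons l (i - 1). mdeg q v = q i}"
proof -
  define s where
    "s = (\<Sum>h = 1..j. const (Poly_Mapping.lookup f (xvar i h)) * monomial (xvar i h))"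
  have zero: "Poly_Mapping.lookup (f - s) (xvar i h) = 0" if "h \<in> {1..j}" for h
  proof -
    have "Poly_Mapping.lookup s (xvar i h) =
        (\<Sum>h' = 1..j. if h' = h then Poly_Mapping.lookup f (xvar i h) else 0)"
      unfolding s_def lookup_sum const_monomial by (rule sum.cong) (auto simp: lookup_single)
    also have "\<dots> = Poly_Mapping.lookup f (xvar i h)"
      using that by simp
    finally show ?thesis by (simp add: lookup_minus)
  qed
  have "Poly_Mapping.keys (const (Poly_Mapping.lookup f (xvar i h)) * monomial (xvar i h))
      \<subseteq> {xvar i h}" for h
    by (simp add: const_monomial)
  then have keys_s: "Poly_Mapping.keys s \<subseteq> xvar i ` {1..j}"
    unfolding s_def using keys_sum by fastforce
  show ?thesis
    unfolding s_def[symmetric]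
  proof
    fix v assume v: "v \<in> Poly_Mapping.keys (f - s)"
    then have "v \<notin> xvar i ` {1..j}"
      using zero by (auto simp: in_keys_iff)
    moreover have "v \<in> insert (xvar i j) (lower_mons l q i j) \<union> xvar i ` {1..j}"
      using v keys_diff[of f s] f keys_s by blast
    moreover have "j \<in> {1..j}" using x by (simp add: vars_def)
    ultimately show "v \<in> {v \<in> mons l (i - 1). mdeg q v = q i}"
      by (auto simp: lower_mons_def)
  qed
qed

text \<open>
  Membership in \<open>T\<close> is a condition on the supports of the images of the variables; gradedness follows
  from it.
\<close>

lemma T_groupI:
  assumes iso: "\<phi> \<in> ring_iso (mpoly_ring l n) (mpoly_ring l n)" "\<And>c. \<phi> (const c) = const c"
    and tri: "triangular n l q \<phi>"
    and diag: "\<And>i j. (i, j) \<in> vars l n \<Longrightarrow> xvar i j \<in> Poly_Mapping.keys (\<phi> (monomial (xvar i j)))"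
  shows "\<phi> \<in> T_group n l q"
proof -
  have endo: "alg_endo n l \<phi>"
    using iso by (simp add: alg_endo_def ring_iso_def)
  have "homogeneous q d (\<phi> f)"
    if "Poly_Mapping.keys f \<subseteq> mons l n" "homogeneous q d f" for d f
    using alg_endo_graded[OF endo order_refl triangular_homogeneous_keys[OF tri order_refl] that]
    by (auto simp: homogeneous_def)
  moreover define a where "a i j h = Poly_Mapping.lookup (\<phi> (monomial (xvar i j))) (xvar i h)" for i j h
  moreover define \<psi> where
    "\<psi> i j = \<phi> (monomial (xvar i j)) - (\<Sum>h = 1..j. const (a i j h) * monomial (xvar i h))" for i j
  have "a i j j \<noteq> 0 \<and> \<psi> i j \<in> carrier (mpoly_ring l (i - 1)) \<and> homogeneous q (q i) (\<psi> i j) \<and>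
      \<phi> (monomial (xvar i j)) = (\<Sum>h = 1..j. const (a i j h) * monomial (xvar i h)) + \<psi> i j"
    if "i \<in> {1..n}" "j \<in> {1..l i}" for i j
  proof (intro conjI)
    have x: "(i, j) \<in> vars l n"
      using that by (simp add: vars_def)
    have "Poly_Mapping.keys (\<phi> (monomial (xvar i j))) \<subseteq> insert (xvar i j) (lower_mons l q i j)"
      using tri x by (simp add: triangular_def)
    from keys_minus_linear_part[OF x this]
    have keys: "Poly_Mapping.keys (\<psi> i j) \<subseteq> {v \<in> mons l (i - 1). mdeg q v = q i}"
      by (simp add: \<psi>_def a_def)
    show "\<psi> i j \<in> carrier (mpoly_ring l (i - 1))" "homogeneous q (q i) (\<psi> i j)"
      using keys by (auto simp: homogeneous_def)
    show "a i j j \<noteq> 0"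
      using diag[OF x] by (simp add: a_def in_keys_iff)
    show "\<phi> (monomial (xvar i j)) = (\<Sum>h = 1..j. const (a i j h) * monomial (xvar i h)) + \<psi> i j"
      by (simp add: \<psi>_def)
  qed
  ultimately show ?thesis
    unfolding T_group_def mem_Collect_eq using iso
    by (intro conjI allI ballI impI exI[of _ a] exI[of _ \<psi>]) auto
qed

lemma T_group_alg_endo: "\<phi> \<in> T_group n l q \<Longrightarrow> alg_endo n l \<phi>"
  by (simp add: T_group_def alg_endo_def ring_iso_def)

lemma T_group_variableE:
  assumes "\<phi> \<in> T_group n l q" "(i, j) \<in> vars l n"
  obtains a \<psi> where "a j \<noteq> 0"
    and "Poly_Mapping.keys \<psi> \<subseteq> mons l (i - 1)" "homogeneous q (q i) \<psi>"
    and "\<phi> (monomial (xvar i j)) = (\<Sum>h = 1..j. const (a h) * monomial (xvar i h)) + \<psi>"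
proof -
  have "\<exists>(a :: nat \<Rightarrow> nat \<Rightarrow> nat \<Rightarrow> 'a) (\<psi> :: nat \<Rightarrow> nat \<Rightarrow> 'a mpoly).
      \<forall>i\<in>{1..n}. \<forall>j\<in>{1..l i}.
        a i j j \<noteq> 0 \<and>
        \<psi> i j \<in> carrier (mpoly_ring l (i - 1)) \<and> homogeneous q (q i) (\<psi> i j) \<and>
        \<phi> (monomial (xvar i j)) =
          (\<Sum>h = 1..j. const (a i j h) * monomial (xvar i h)) + \<psi> i j"
    using assms(1) unfolding T_group_def mem_Collect_eq by (elim conjE)
  moreover have "i \<in> {1..n}" "j \<in> {1..l i}"
    using assms(2) by (simp_all add: vars_def)
  ultimately obtain a :: "nat \<Rightarrow> nat \<Rightarrow> nat \<Rightarrow> 'a" and \<psi> :: "nat \<Rightarrow> nat \<Rightarrow> 'a mpoly"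
    where "a i j j \<noteq> 0 \<and> \<psi> i j \<in> carrier (mpoly_ring l (i - 1)) \<and> homogeneous q (q i) (\<psi> i j) \<and>
        \<phi> (monomial (xvar i j)) = (\<Sum>h = 1..j. const (a i j h) * monomial (xvar i h)) + \<psi> i j"
    by blast
  then show ?thesis
    by (intro that[of "a i j" "\<psi> i j"]) simp_all
qed

lemma T_group_triangular:
  assumes "\<phi> \<in> T_group n l q"
  shows "triangular n l q \<phi>"
  unfolding triangular_def
proof (intro allI impI)
  fix i j assume x: "(i, j) \<in> vars l n"
  obtain a \<psi> where "a j \<noteq> 0" and \<psi>: "Poly_Mapping.keys \<psi> \<subseteq> mons l (i - 1)" "homogeneous q (q i) \<psi>"
    and \<phi>: "\<phi> (monomial (xvar i j)) = (\<Sum>h = 1..j. const (a h) * monomial (xvar i h)) + \<psi>"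
    using T_group_variableE[OF assms x] .
  have "Poly_Mapping.keys (\<Sum>h = 1..j. const (a h) * monomial (xvar i h)) \<subseteq> xvar i ` {1..j}"
    using keys_sum[of "\<lambda>h. const (a h) * monomial (xvar i h)" "{1..j}"]
    by (fastforce simp: const_monomial split: if_splits)
  moreover have "xvar i ` {1..j} \<subseteq> insert (xvar i j) (lower_mons l q i j)"
    by (auto simp: lower_mons_def)
  moreover have "Poly_Mapping.keys \<psi> \<subseteq> lower_mons l q i j"
    using \<psi> by (auto simp: lower_mons_def homogeneous_def)
  ultimately show "Poly_Mapping.keys (\<phi> (monomial (xvar i j))) \<subseteq> insert (xvar i j) (lower_mons l q i j)"
    unfolding \<phi> using keys_add[of "\<Sum>h = 1..j. const (a h) * monomial (xvar i h)" \<psi>] by blast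
qed

text \<open>
  Applying the inverse \<open>\<chi>\<close> to the formula for \<open>\<phi> X\<^sub>i\<^sub>j\<close> and solving for \<open>\<chi> X\<^sub>i\<^sub>j\<close> gives
  \<open>a\<^sub>j \<chi> X\<^sub>i\<^sub>j = X\<^sub>i\<^sub>j - (\<Sum>h<j. a\<^sub>h \<chi> X\<^sub>i\<^sub>h) - \<chi> \<psi>\<close>, where \<open>a\<^sub>j \<noteq> 0\<close>. The sum is covered by
  induction on \<open>j\<close>, and \<open>\<chi> \<psi>\<close> by induction on \<open>i\<close>, because only variables of earlier groups occur
  in \<open>\<psi>\<close>.
\<close>

lemma T_group_inverse_triangular:
  assumes T: "\<phi> \<in> T_group n l q" and endo: "alg_endo n l \<chi>"
    and inv: "\<And>f. Poly_Mapping.keys f \<subseteq> mons l n \<Longrightarrow> \<chi> (\<phi> f) = f"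
  shows "triangular n l q \<chi>"
proof -
  have "Poly_Mapping.keys (\<chi> (monomial (xvar i j))) \<subseteq> insert (xvar i j) (lower_mons l q i j)"
    if "(i, j) \<in> vars l n" for i j
    using that
  proof (induction i arbitrary: j rule: less_induct)
    case (less i)
    note IH_i = less.IH
    show ?case
      using less.prems
    proof (induction j rule: less_induct)
      case (less j)
      note IH_j = less.IH
      have i: "i \<in> {1..n}" and j: "j \<in> {1..l i}" using less.prems by (auto simp: vars_def)
      obtain a \<psi> where a: "a j \<noteq> 0"
        and \<psi>: "Poly_Mapping.keys \<psi> \<subseteq> mons l (i - 1)" "homogeneous q (q i) \<psi>"
        and \<phi>: "\<phi> (monomial (xvar i j)) = (\<Sum>h = 1..j. const (a h) * monomial (xvar i h)) + \<psi>"
        using T_group_variableE[OF T less.prems] .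
      have \<psi>_carrier: "Poly_Mapping.keys \<psi> \<subseteq> mons l n"
        using \<psi>(1) by (rule order_trans) (use i in \<open>auto intro!: mons_mono\<close>)
      have x_carrier: "(i, h) \<in> vars l n" if "h \<in> {1..j}" for h
        using that i j by (auto simp: vars_def)
      let ?t = "\<lambda>h. const (a h) * \<chi> (monomial (xvar i h))"
      have t_carrier: "Poly_Mapping.keys (const (a h) * monomial (xvar i h)) \<subseteq> mons l n"
        if "h \<in> {1..j}" for h
        using x_carrier[OF that] by (auto simp: const_monomial)
      have "monomial (xvar i j) = \<chi> (\<phi> (monomial (xvar i j)))"
        using less.prems by (simp add: inv)
      also have "\<dots> = \<chi> (\<Sum>h = 1..j. const (a h) * monomial (xvar i h)) + \<chi> \<psi>"
      proof -
        have "Poly_Mapping.keys (\<Sum>h = 1..j. const (a h) * monomial (xvar i h)) \<subseteq> mons l n"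
          using keys_sum[of "\<lambda>h. const (a h) * monomial (xvar i h)" "{1..j}"] t_carrier by blast
        then show ?thesis
          unfolding \<phi> by (rule alg_endo_add[OF endo _ \<psi>_carrier])
      qed
      also have "\<chi> (\<Sum>h = 1..j. const (a h) * monomial (xvar i h)) =
          (\<Sum>h = 1..j. \<chi> (const (a h) * monomial (xvar i h)))"
        by (rule alg_endo_sum[OF endo t_carrier])
      also have "\<dots> = (\<Sum>h = 1..j. ?t h)"
        by (rule sum.cong[OF refl], rule alg_endo_const_mult[OF endo]) (use x_carrier in simp)
      also have "{1..j} = insert j {1..<j}"
        using j by auto
      also have "sum ?t (insert j {1..<j}) = ?t j + (\<Sum>h = 1..<j. ?t h)"
        by simp
      finally have eq: "?t j = monomial (xvar i j) - (\<Sum>h = 1..<j. ?t h) - \<chi> \<psi>"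
        by (simp add: algebra_simps)
      have "Poly_Mapping.keys (?t h) \<subseteq> lower_mons l q i j" if h: "h \<in> {1..<j}" for h
      proof -
        have "Poly_Mapping.keys (\<chi> (monomial (xvar i h))) \<subseteq> insert (xvar i h) (lower_mons l q i h)"
          using h x_carrier[of h] by (intro IH_j) auto
        also have "\<dots> \<subseteq> lower_mons l q i j"
          using h by (auto simp: lower_mons_def)
        finally show ?thesis
          using keys_const_mult_subset by blast
      qed
      then have "Poly_Mapping.keys (\<Sum>h = 1..<j. ?t h) \<subseteq> lower_mons l q i j"
        using keys_sum[of ?t "{1..<j}"] by blast
      moreover have "Poly_Mapping.keys (\<chi> \<psi>) \<subseteq> lower_mons l q i j"
      proof -
        have "Poly_Mapping.keys (\<chi> (monomial (xvar i' j'))) \<subseteq> {v \<in> mons l (i - 1). mdeg q v = q i'}"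
          if x': "(i', j') \<in> vars l (i - 1)" for i' j'
        proof -
          have "i' < i" "(i', j') \<in> vars l n"
            using x' i by (auto simp: vars_def)
          then have "Poly_Mapping.keys (\<chi> (monomial (xvar i' j'))) \<subseteq> insert (xvar i' j') (lower_mons l q i' j')"
            by (rule IH_i)
          then show ?thesis
            using x' lower_mons_subset[OF x', of q] by fastforce
        qed
        then have "Poly_Mapping.keys (\<chi> \<psi>) \<subseteq> {v \<in> mons l (i - 1). mdeg q v = q i}"
          using i by (intro alg_endo_graded[OF endo _ _ \<psi>]) auto
        then show ?thesis by (auto simp: lower_mons_def)
      qed
      ultimately have "Poly_Mapping.keys (?t j) \<subseteq> insert (xvar i j) (lower_mons l q i j)"
        unfolding eq
        using keys_diff[of "monomial (xvar i j) - (\<Sum>h = 1..<j. ?t h)" "\<chi> \<psi>"]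
          keys_diff[of "monomial (xvar i j)" "\<Sum>h = 1..<j. ?t h"]
        by (simp only: keys_monomial) blast
      then show ?case
        by (simp add: keys_const_mult[OF a])
    qed
  qed
  then show ?thesis by (simp add: triangular_def)
qed

lemma strongly_stable_imp_T_fixed:
  assumes stable: "strongly_stable n l q I"
  shows "T_fixed n l q I"
  unfolding T_fixed_def
proof
  let ?R = "mpoly_ring l n :: 'a mpoly ring"
  fix \<phi> :: "'a mpoly \<Rightarrow> 'a mpoly" assume T: "\<phi> \<in> T_group n l q"
  have iso: "\<phi> \<in> ring_iso ?R ?R"
    using T by (simp add: T_group_def)
  have bij: "bij_betw \<phi> (carrier ?R) (carrier ?R)"
    using iso by (simp add: ring_iso_def)
  have ideal: "ideal I ?R"
    using stable by (simp add: strongly_stable_def monomial_ideal_def)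
  define \<chi> where "\<chi> = inv_into (carrier ?R) \<phi>"
  have left: "\<chi> (\<phi> f) = f" and right: "\<phi> (\<chi> f) = f" if "f \<in> carrier ?R" for f
    using that bij unfolding \<chi>_def
    by (auto simp: bij_betw_inv_into_left bij_betw_inv_into_right simp del: mpoly_ring_simps)
  have "\<chi> \<in> ring_iso ?R ?R"
    unfolding \<chi>_def using iso cring.axioms(1)[OF mpoly_ring_cring] by (rule ring_iso_set_sym[rotated])
  moreover have "\<chi> (const c) = const c" for c
  proof -
    have "const c \<in> carrier ?R"
      using keys_const[of c] by auto
    then have "\<chi> (\<phi> (const c)) = const c" by (rule left)
    then show ?thesis by (simp add: alg_endo_const[OF T_group_alg_endo[OF T]])
  qed
  ultimately have endo: "alg_endo n l \<chi>"
    by (simp add: alg_endo_def ring_iso_def)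
  have tri: "triangular n l q \<chi>"
    using left by (intro T_group_inverse_triangular[OF T endo]) simp
  show "\<phi> ` I = I"
  proof
    show "\<phi> ` I \<subseteq> I"
      using triangular_strongly_stable[OF T_group_alg_endo[OF T] T_group_triangular[OF T] stable]
      by blast
    show "I \<subseteq> \<phi> ` I"
    proof
      fix f assume f: "f \<in> I"
      then have "f = \<phi> (\<chi> f)"
        using right[of f] ideal_subset_carrier[OF ideal f] by simp
      then show "f \<in> \<phi> ` I"
        using triangular_strongly_stable[OF endo tri stable f] by blast
    qed
  qed
qed

section \<open>Substitution\<close>

definition mon_subst :: "(nat \<times> nat \<Rightarrow> 'k::field_char_0 mpoly) \<Rightarrow> mon \<Rightarrow> 'k mpoly" where
  "mon_subst \<sigma> m = (\<Prod>x\<in>Poly_Mapping.keys m. \<sigma> x ^ Poly_Mapping.lookup m x)"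

definition poly_subst :: "(nat \<times> nat \<Rightarrow> 'k::field_char_0 mpoly) \<Rightarrow> 'k mpoly \<Rightarrow> 'k mpoly" where
  "poly_subst \<sigma> f = (\<Sum>m\<in>Poly_Mapping.keys f. const (Poly_Mapping.lookup f m) * mon_subst \<sigma> m)"

text \<open>
  The index set in \<open>mon_subst\<close> depends on the monomial; two monomials can be compared over a common
  finite index set.
\<close>

lemma mon_subst_superset:
  assumes "finite A" "Poly_Mapping.keys m \<subseteq> A"
  shows "mon_subst \<sigma> m = (\<Prod>x\<in>A. \<sigma> x ^ Poly_Mapping.lookup m x)"
  unfolding mon_subst_def
  using assms by (intro prod.mono_neutral_left) (auto simp: in_keys_iff)

lemma mon_subst_add: "mon_subst \<sigma> (u + v) = mon_subst \<sigma> u * mon_subst \<sigma> v"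
proof -
  let ?A = "Poly_Mapping.keys u \<union> Poly_Mapping.keys v"
  have "mon_subst \<sigma> w = (\<Prod>x\<in>?A. \<sigma> x ^ Poly_Mapping.lookup w x)" if "w \<in> {u, v, u + v}" for w
    using that keys_add[of u v] by (intro mon_subst_superset) auto
  then show ?thesis
    by (simp add: lookup_add power_add prod.distrib)
qed

lemma mon_subst_zero [simp]: "mon_subst \<sigma> 0 = 1"
  by (simp add: mon_subst_def)

lemma subst_const_monomial: "poly_subst \<sigma> (const c * monomial u) = const c * mon_subst \<sigma> u"
  by (simp add: poly_subst_def const_monomial)

lemma subst_monomial: "poly_subst \<sigma> (monomial u) = mon_subst \<sigma> u"
  using subst_const_monomial[of \<sigma> 1 u] by simp

lemma subst_const [simp]: "poly_subst \<sigma> (const c) = const c"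
  using subst_const_monomial[of \<sigma> c 0] by simp

lemma subst_xvar: "poly_subst \<sigma> (monomial (xvar i j)) = \<sigma> (i, j)"
  by (simp add: subst_monomial mon_subst_def xvar_def)

lemma subst_add: "poly_subst \<sigma> (f + g) = poly_subst \<sigma> f + poly_subst \<sigma> g"
  unfolding poly_subst_def
  by (rule setsum_keys_plus_distrib) (simp_all add: const_add algebra_simps)

lemma subst_zero [simp]: "poly_subst \<sigma> 0 = 0"
  by (simp add: poly_subst_def)

lemma subst_sum: "poly_subst \<sigma> (sum f A) = (\<Sum>x\<in>A. poly_subst \<sigma> (f x))"
  by (induction A rule: infinite_finite_induct) (simp_all add: subst_add)

lemma subst_mult: "poly_subst \<sigma> (f * g) = poly_subst \<sigma> f * poly_subst \<sigma> g"
proof -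
  let ?t = "\<lambda>f m. const (Poly_Mapping.lookup f m) * monomial m"
  let ?s = "\<lambda>f m. const (Poly_Mapping.lookup f m) * mon_subst \<sigma> m"
  have summand: "poly_subst \<sigma> (?t f u * ?t g v) = ?s f u * ?s g v" for u v
  proof -
    have "?t f u * ?t g v = const (Poly_Mapping.lookup f u * Poly_Mapping.lookup g v) * monomial (u + v)"
      by (simp add: const_mult monomial_add ac_simps)
    then show ?thesis
      by (simp only: subst_const_monomial) (simp add: const_mult mon_subst_add ac_simps)
  qed
  have "f * g = (\<Sum>u\<in>Poly_Mapping.keys f. ?t f u) * (\<Sum>v\<in>Poly_Mapping.keys g. ?t g v)"
    by (simp flip: poly_expand)
  also have "\<dots> = (\<Sum>u\<in>Poly_Mapping.keys f. \<Sum>v\<in>Poly_Mapping.keys g. ?t f u * ?t g v)"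
    by (rule sum_product)
  finally have "poly_subst \<sigma> (f * g) = (\<Sum>u\<in>Poly_Mapping.keys f. \<Sum>v\<in>Poly_Mapping.keys g. ?s f u * ?s g v)"
    by (simp only: subst_sum summand)
  also have "\<dots> = poly_subst \<sigma> f * poly_subst \<sigma> g"
    by (simp only: poly_subst_def sum_product)
  finally show ?thesis .
qed

lemma mult_in_carrier:
  "Poly_Mapping.keys f \<subseteq> mons l k \<Longrightarrow> Poly_Mapping.keys g \<subseteq> mons l k \<Longrightarrow>
    Poly_Mapping.keys (f * g) \<subseteq> mons l k"
  using keys_mult[of f g] mons_add by blast

lemma subst_in_carrier:
  assumes "\<And>i j. (i, j) \<in> vars l k \<Longrightarrow> Poly_Mapping.keys (\<sigma> (i, j)) \<subseteq> mons l k"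
    and "Poly_Mapping.keys f \<subseteq> mons l k"
  shows "Poly_Mapping.keys (poly_subst \<sigma> f) \<subseteq> mons l k"
  using assms(2)
proof (induction f rule: poly_in_carrier_induct)
  case (const c)
  then show ?case using keys_const[of c] by auto
next
  case (monomial i j)
  then show ?case by (simp add: subst_xvar assms(1))
next
  case (add f g)
  then show ?case using keys_add[of "poly_subst \<sigma> f" "poly_subst \<sigma> g"] by (auto simp: subst_add)
next
  case (mult f g)
  then show ?case by (simp add: subst_mult mult_in_carrier)
qed

lemma subst_inverse:
  assumes "\<And>i j. (i, j) \<in> vars l k \<Longrightarrow> poly_subst \<sigma> (\<sigma>' (i, j)) = monomial (xvar i j)"
    and "Poly_Mapping.keys f \<subseteq> mons l k"
  shows "poly_subst \<sigma> (poly_subst \<sigma>' f) = f"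
  using assms(2)
  by (induction f rule: poly_in_carrier_induct)
    (simp_all add: subst_xvar assms(1) subst_add subst_mult)

lemma subst_ring_iso:
  assumes "\<And>i j. (i, j) \<in> vars l n \<Longrightarrow> Poly_Mapping.keys (\<sigma> (i, j)) \<subseteq> mons l n"
    and "\<And>i j. (i, j) \<in> vars l n \<Longrightarrow> Poly_Mapping.keys (\<sigma>' (i, j)) \<subseteq> mons l n"
    and "\<And>i j. (i, j) \<in> vars l n \<Longrightarrow> poly_subst \<sigma> (\<sigma>' (i, j)) = monomial (xvar i j)"
    and "\<And>i j. (i, j) \<in> vars l n \<Longrightarrow> poly_subst \<sigma>' (\<sigma> (i, j)) = monomial (xvar i j)"
  shows "poly_subst \<sigma> \<in> ring_iso (mpoly_ring l n) (mpoly_ring l n)"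
proof (rule ring_iso_memI)
  show "bij_betw (poly_subst \<sigma>) (carrier (mpoly_ring l n)) (carrier (mpoly_ring l n))"
  proof (rule bij_betw_byWitness)
    show "\<forall>f\<in>carrier (mpoly_ring l n). poly_subst \<sigma>' (poly_subst \<sigma> f) = f"
      using subst_inverse[of l n \<sigma>' \<sigma>, OF assms(4)] by simp
    show "\<forall>f\<in>carrier (mpoly_ring l n). poly_subst \<sigma> (poly_subst \<sigma>' f) = f"
      using subst_inverse[of l n \<sigma> \<sigma>', OF assms(3)] by simp
    show "poly_subst \<sigma> ` carrier (mpoly_ring l n) \<subseteq> carrier (mpoly_ring l n)"
      using subst_in_carrier[of l n \<sigma>, OF assms(1)] by auto
    show "poly_subst \<sigma>' ` carrier (mpoly_ring l n) \<subseteq> carrier (mpoly_ring l n)"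
      using subst_in_carrier[of l n \<sigma>', OF assms(2)] by auto
  qed
next
  show "poly_subst \<sigma> \<one>\<^bsub>mpoly_ring l n\<^esub> = \<one>\<^bsub>mpoly_ring l n\<^esub>"
    using subst_const[of \<sigma> 1] by (simp del: subst_const)
qed (use subst_in_carrier[of l n \<sigma>, OF assms(1)] in \<open>simp_all add: subst_add subst_mult\<close>)

section \<open>Elementary automorphisms\<close>

text \<open>
  The images of the variables under the automorphism that replaces \<open>X\<^sub>i\<^sub>j\<close> by \<open>t X\<^sub>i\<^sub>j + p\<close>.
\<close>

definition elementary ::
  "nat \<Rightarrow> nat \<Rightarrow> 'k::field_char_0 \<Rightarrow> 'k mpoly \<Rightarrow> nat \<times> nat \<Rightarrow> 'k mpoly" where
  "elementary i j t p =
    (\<lambda>(i', j'). monomial (xvar i' j'))((i, j) := const t * monomial (xvar i j) + p)"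

lemma elementary_same: "elementary i j t p (i, j) = const t * monomial (xvar i j) + p"
  by (simp add: elementary_def)

lemma elementary_other:
  "(i', j') \<noteq> (i, j) \<Longrightarrow> elementary i j t p (i', j') = monomial (xvar i' j')"
  by (auto simp: elementary_def)

lemma mon_subst_elementary_fixed:
  assumes "Poly_Mapping.lookup m (i, j) = 0"
  shows "mon_subst (elementary i j t p) m = monomial m"
proof -
  have "mon_subst (elementary i j t p) m =
      (\<Prod>x\<in>Poly_Mapping.keys m. monomial (Poly_Mapping.single x (Poly_Mapping.lookup m x)))"
    unfolding mon_subst_def
  proof (rule prod.cong[OF refl])
    fix x assume "x \<in> Poly_Mapping.keys m"
    then have "x \<noteq> (i, j)" using assms by (auto simp: in_keys_iff)
    then have "elementary i j t p x = monomial (Poly_Mapping.single x 1)"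
      by (cases x) (simp add: elementary_other xvar_def)
    then show "elementary i j t p x ^ Poly_Mapping.lookup m x =
        monomial (Poly_Mapping.single x (Poly_Mapping.lookup m x))"
      by (simp only: monomial_single_power)
  qed
  also have "\<dots> = monomial (\<Sum>x\<in>Poly_Mapping.keys m. Poly_Mapping.single x (Poly_Mapping.lookup m x))"
    by (simp add: monomial_sum)
  also have "(\<Sum>x\<in>Poly_Mapping.keys m. Poly_Mapping.single x (Poly_Mapping.lookup m x)) = m"
    by (rule poly_mapping_eqI) (simp add: lookup_sum lookup_single when_def in_keys_iff)
  finally show ?thesis .
qed

lemma subst_elementary_fixed:
  assumes "\<And>m. m \<in> Poly_Mapping.keys f \<Longrightarrow> Poly_Mapping.lookup m (i, j) = 0"
  shows "poly_subst (elementary i j t p) f = f"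
proof -
  have "poly_subst (elementary i j t p) f =
      (\<Sum>m\<in>Poly_Mapping.keys f. const (Poly_Mapping.lookup f m) * monomial m)"
    unfolding poly_subst_def using assms by (intro sum.cong) (simp_all add: mon_subst_elementary_fixed)
  then show ?thesis by (simp flip: poly_expand)
qed

lemma subst_elementary_monomial:
  assumes "Poly_Mapping.lookup w (i, j) = 0"
  shows "poly_subst (elementary i j t p) (monomial (Poly_Mapping.single (i, j) a + w)) =
    (const t * monomial (xvar i j) + p) ^ a * monomial w"
  using assms
  by (cases "a = 0")
    (simp_all add: subst_monomial mon_subst_add mon_subst_elementary_fixed,
      simp_all add: mon_subst_def elementary_same)

text \<open>
  As \<open>p\<close> does not involve \<open>X\<^sub>i\<^sub>j\<close>, the inverse substitution replaces \<open>X\<^sub>i\<^sub>j\<close> by \<open>(X\<^sub>i\<^sub>j - p) / t\<close>, which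
  is again of elementary form.
\<close>

lemma elementary_in_T_group:
  assumes x: "(i, j) \<in> vars l n" and t: "t \<noteq> 0"
    and p: "Poly_Mapping.keys p \<subseteq> lower_mons l q i j"
  shows "poly_subst (elementary i j t p) \<in> T_group n l q"
proof (rule T_groupI)
  let ?p' = "const (- 1 / t) * p"
  have p': "Poly_Mapping.keys ?p' \<subseteq> lower_mons l q i j"
    using p keys_const_mult_subset by blast
  have tri: "Poly_Mapping.keys (elementary i j s r (i', j')) \<subseteq> insert (xvar i' j') (lower_mons l q i' j')"
    if "Poly_Mapping.keys r \<subseteq> lower_mons l q i j" for s r i' j'
  proof (cases "(i', j') = (i, j)")
    case True
    have "Poly_Mapping.keys (const s * monomial (xvar i j)) \<subseteq> {xvar i j}"
      using keys_const_mult_subset[of s "monomial (xvar i j)"] by simp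
    then show ?thesis
      using True that keys_add[of "const s * monomial (xvar i j)" r] by (auto simp: elementary_same)
  qed (simp add: elementary_other)
  have carrier: "Poly_Mapping.keys (elementary i j s r (i', j')) \<subseteq> mons l n"
    if "Poly_Mapping.keys r \<subseteq> lower_mons l q i j" "(i', j') \<in> vars l n" for s r i' j'
    using tri[OF that(1), of s i' j'] lower_mons_subset[OF that(2), of q] that(2) by fastforce
  have inv: "poly_subst (elementary i j s r) (elementary i j (1 / s) (const (- 1 / s) * r) (i', j')) =
      monomial (xvar i' j')"
    if s: "s \<noteq> 0" and r: "Poly_Mapping.keys r \<subseteq> lower_mons l q i j" for s r i' j'
  proof (cases "(i', j') = (i, j)")
    case True
    have r_fixed: "poly_subst (elementary i j s r) r = r"
      using r xvar_notin_lower_mons[OF x] by (intro subst_elementary_fixed) blast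
    have "poly_subst (elementary i j s r) (elementary i j (1 / s) (const (- 1 / s) * r) (i, j)) =
        const (1 / s) * (const s * monomial (xvar i j) + r) + const (- 1 / s) * r"
      by (simp only: elementary_same subst_add subst_mult subst_const subst_xvar r_fixed)
    also have "\<dots> = const (1 / s * s) * monomial (xvar i j) + const (1 / s + - 1 / s) * r"
      by (simp only: const_add const_mult algebra_simps)
    also have "\<dots> = monomial (xvar i j)"
      using s by simp
    finally show ?thesis using True by simp
  qed (simp add: elementary_other subst_xvar)
  show "poly_subst (elementary i j t p) \<in> ring_iso (mpoly_ring l n) (mpoly_ring l n)"
  proof (rule subst_ring_iso[where \<sigma>' = "elementary i j (1 / t) ?p'"])
    show "poly_subst (elementary i j (1 / t) ?p') (elementary i j t p (i', j')) = monomial (xvar i' j')" for i' j'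
    proof -
      \<comment> \<open>Inverting twice gives back \<open>t\<close> and \<open>p\<close>, so the second composite is an instance of the first.\<close>
      have "const (- 1 / (1 / t)) * ?p' = const (- 1 / (1 / t) * (- 1 / t)) * p"
        by (simp only: const_mult mult.assoc)
      then have "const (- 1 / (1 / t)) * ?p' = p" "1 / (1 / t) = t"
        using t by simp_all
      then show ?thesis
        using inv[of "1 / t" ?p' i' j'] p' t by (simp only:) simp
    qed
    show "poly_subst (elementary i j t p) (elementary i j (1 / t) ?p' (i', j')) = monomial (xvar i' j')" for i' j'
      using t p by (rule inv)
    show "Poly_Mapping.keys (elementary i j t p (i', j')) \<subseteq> mons l n" if "(i', j') \<in> vars l n" for i' j'
      using p that by (rule carrier)
    show "Poly_Mapping.keys (elementary i j (1 / t) ?p' (i', j')) \<subseteq> mons l n" if "(i', j') \<in> vars l n" for i' j'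
      using p' that by (rule carrier)
  qed
  show "triangular n l q (poly_subst (elementary i j t p))"
    using tri[OF p] by (simp add: triangular_def subst_xvar)
  show "xvar i' j' \<in> Poly_Mapping.keys (poly_subst (elementary i j t p) (monomial (xvar i' j')))" for i' j'
  proof (cases "(i', j') = (i, j)")
    case True
    have "Poly_Mapping.lookup p (xvar i j) = 0"
    proof (rule ccontr)
      assume "Poly_Mapping.lookup p (xvar i j) \<noteq> 0"
      then have "xvar i j \<in> lower_mons l q i j"
        using p by (auto simp: in_keys_iff)
      then show False
        using xvar_notin_lower_mons[OF x] by (fastforce simp: lookup_xvar)
    qed
    then show ?thesis
      using True t by (simp add: subst_xvar elementary_same in_keys_iff lookup_add const_monomial)
  qed (simp add: subst_xvar elementary_other)
qed simp

section \<open>Fixed ideals are strongly stable\<close>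

lemma T_fixed_subst_elementary:
  assumes "T_fixed n l q I" "(i, j) \<in> vars l n" "t \<noteq> 0"
    and "Poly_Mapping.keys p \<subseteq> lower_mons l q i j" "f \<in> I"
  shows "poly_subst (elementary i j t p) f \<in> I"
  using assms elementary_in_T_group[OF assms(2-4)] unfolding T_fixed_def by blast

lemma single_add_split:
  obtains w :: "'a \<Rightarrow>\<^sub>0 nat"
  where "u = Poly_Mapping.single x (Poly_Mapping.lookup u x) + w" "Poly_Mapping.lookup w x = 0"
proof
  let ?w = "u - Poly_Mapping.single x (Poly_Mapping.lookup u x)"
  show "u = Poly_Mapping.single x (Poly_Mapping.lookup u x) + ?w"
    by (rule poly_mapping_eqI) (simp add: lookup_add lookup_minus lookup_single when_def)
  show "Poly_Mapping.lookup ?w x = 0"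
    by (simp add: lookup_minus)
qed

lemma lookup_subst_scaling:
  "Poly_Mapping.lookup (poly_subst (elementary i j t 0) f) m =
    t ^ Poly_Mapping.lookup m (i, j) * Poly_Mapping.lookup f m"
proof -
  have mon: "mon_subst (elementary i j t 0) u = const (t ^ Poly_Mapping.lookup u (i, j)) * monomial u" for u
  proof -
    obtain w where w: "u = Poly_Mapping.single (i, j) (Poly_Mapping.lookup u (i, j)) + w"
    "Poly_Mapping.lookup w (i, j) = 0"
      by (rule single_add_split)
    define a where "a = Poly_Mapping.lookup u (i, j)"
    have const_power: "const t ^ a = const (t ^ a)" for a
      by (induction a) (simp_all add: const_mult)
    have "poly_subst (elementary i j t 0) (monomial (Poly_Mapping.single (i, j) a + w)) =
        const (t ^ a) * (monomial (xvar i j) ^ a * monomial w)"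
      by (simp add: subst_elementary_monomial[OF w(2)] power_mult_distrib const_power mult.assoc)
    also have "monomial (xvar i j) ^ a * monomial w = (monomial (Poly_Mapping.single (i, j) a + w) :: 'a mpoly)"
      unfolding xvar_def monomial_single_power monomial_add ..
    finally show ?thesis
      using w(1) by (simp add: a_def subst_monomial)
  qed
  have "poly_subst (elementary i j t 0) f =
      (\<Sum>u\<in>Poly_Mapping.keys f. Poly_Mapping.single u (t ^ Poly_Mapping.lookup u (i, j) * Poly_Mapping.lookup f u))"
    unfolding poly_subst_def mon
    by (intro sum.cong refl) (simp add: const_mult ac_simps flip: const_monomial)
  then show ?thesis
    by (simp add: lookup_sum lookup_single when_def in_keys_iff)
qed

text \<open>
  Induction on the number of monomials in \<open>f\<close>. If a monomial \<open>m'\<close> other than \<open>m\<close> occurs in \<open>f\<close>, pick a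
  variable in which their exponents differ and scale it by \<open>2\<close>. Subtracting the multiple of \<open>f\<close> by the
  eigenvalue of \<open>m'\<close> removes \<open>m'\<close>, keeps \<open>m\<close>, and creates no new monomials.
\<close>

lemma T_fixed_monomials:
  fixes I :: "'k::field_char_0 mpoly set"
  assumes ideal: "ideal I (mpoly_ring l n)" and fixed: "T_fixed n l q I"
    and "f \<in> I" "m \<in> Poly_Mapping.keys f"
  shows "monomial m \<in> I"
  using assms(3,4)
proof (induction "card (Poly_Mapping.keys f)" arbitrary: f rule: less_induct)
  case less
  have carrier: "Poly_Mapping.keys f \<subseteq> mons l n"
    by (rule ideal_subset_carrier[OF ideal less.prems(1)])
  have const_mult_I: "const c * g \<in> I" if "g \<in> I" for c g
    using keys_const[of c] by (intro ideal_mult[OF ideal that]) auto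
  show ?case
  proof (cases "Poly_Mapping.keys f = {m}")
    case True
    define c where "c = Poly_Mapping.lookup f m"
    have "c \<noteq> 0"
      using less.prems(2) by (simp add: c_def in_keys_iff)
    have "f = const c * monomial m"
      using poly_expand[of f] by (simp add: True c_def)
    then have "const (1 / c) * f = monomial m"
      using \<open>c \<noteq> 0\<close> by (simp flip: mult.assoc const_mult)
    then show ?thesis
      using const_mult_I[OF less.prems(1), of "1 / c"] by simp
  next
    case False
    then obtain m' where m': "m' \<in> Poly_Mapping.keys f" "m' \<noteq> m"
      using less.prems(2) by blast
    then obtain i j where ij: "Poly_Mapping.lookup m' (i, j) \<noteq> Poly_Mapping.lookup m (i, j)"
      using poly_mapping_eqI[of m' m] by auto
    then have "(i, j) \<in> Poly_Mapping.keys m' \<union> Poly_Mapping.keys m"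
      by (auto simp: in_keys_iff)
    then have x: "(i, j) \<in> vars l n"
      using carrier m' less.prems(2) by (auto simp: mons_def)
    define c where "c = (2 :: 'k) ^ Poly_Mapping.lookup m' (i, j)"
    define g where "g = poly_subst (elementary i j 2 0) f + const (- c) * f"
    have lookup_g: "Poly_Mapping.lookup g u = (2 ^ Poly_Mapping.lookup u (i, j) - c) * Poly_Mapping.lookup f u" for u
      by (simp add: g_def lookup_add lookup_subst_scaling lookup_const_mult left_diff_distrib)
    have "poly_subst (elementary i j 2 0) f \<in> I"
      using fixed x less.prems(1) by (intro T_fixed_subst_elementary) auto
    then have "g \<in> I"
      unfolding g_def
      using additive_subgroup.a_closed[OF ideal.axioms(1)[OF ideal]] const_mult_I[OF less.prems(1)] by simp
    moreover have "m' \<notin> Poly_Mapping.keys g"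
      by (simp add: in_keys_iff lookup_g c_def)
    then have "Poly_Mapping.keys g \<subset> Poly_Mapping.keys f"
      using m'(1) by (auto simp: in_keys_iff lookup_g)
    then have "card (Poly_Mapping.keys g) < card (Poly_Mapping.keys f)"
      by (intro psubset_card_mono) auto
    moreover have "m \<in> Poly_Mapping.keys g"
    proof -
      \<comment> \<open>In characteristic \<open>0\<close> the powers of \<open>2\<close> are distinct.\<close>
      have "(2 :: 'k) ^ a = 2 ^ b \<Longrightarrow> a = b" for a b :: nat
        using of_nat_eq_iff[of "2 ^ a" "2 ^ b", where ?'a = 'k] by simp
      then show ?thesis
        using less.prems(2) ij by (auto simp: in_keys_iff lookup_g c_def)
    qed
    ultimately show ?thesis
      using less.hyps by blast
  qed
qed

text \<open>
  Substituting \<open>X\<^sub>i\<^sub>j + v\<close> for \<open>X\<^sub>i\<^sub>j\<close> turns \<open>u = X\<^sub>i\<^sub>j\<^sup>a w\<close>, with \<open>w\<close> free of \<open>X\<^sub>i\<^sub>j\<close>, into a binomial sum whose terms have distinct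
  exponents of \<open>X\<^sub>i\<^sub>j\<close>, so nothing cancels. The term in which exactly one factor has been replaced has
  coefficient \<open>a \<noteq> 0\<close>.
\<close>

lemma T_fixed_lower:
  fixes I :: "'k::field_char_0 mpoly set"
  assumes ideal: "ideal I (mpoly_ring l n)" and fixed: "T_fixed n l q I"
    and x: "(i, j) \<in> vars l n" and v: "v \<in> lower_mons l q i j"
    and u: "monomial u \<in> I" "0 < Poly_Mapping.lookup u (i, j)"
  shows "monomial ((v + u) - xvar i j) \<in> I"
proof -
  obtain w where w: "u = Poly_Mapping.single (i, j) (Poly_Mapping.lookup u (i, j)) + w"
    "Poly_Mapping.lookup w (i, j) = 0"
    by (rule single_add_split)
  obtain b where b: "Poly_Mapping.lookup u (i, j) = Suc b"
    using u(2) by (cases "Poly_Mapping.lookup u (i, j)") auto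
  \<comment> \<open>The monomial \<open>X\<^sub>i\<^sub>j\<^sup>k v\<^bsup>a-k\<^esup> w\<close> for \<open>a = b + 1\<close>; the wanted one is \<open>\<mu> b\<close>.\<close>
  define \<mu> where "\<mu> k = Poly_Mapping.single (i, j) k + (\<Sum>_<Suc b - k. v) + w" for k
  have lookup_\<mu>: "Poly_Mapping.lookup (\<mu> k) (i, j) = k" for k
    using xvar_notin_lower_mons[OF x v] w(2) by (simp add: \<mu>_def lookup_add lookup_sum)
  define g where "g = poly_subst (elementary i j 1 (monomial v :: 'k mpoly)) (monomial u)"
  have "g \<in> I"
    unfolding g_def using v by (intro T_fixed_subst_elementary[OF fixed x] u) auto
  have "g = (monomial (xvar i j) + monomial v) ^ Suc b * monomial w"
    unfolding g_def using subst_elementary_monomial[OF w(2), of 1 "monomial v" "Suc b"] w(1) b by simp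
  also have "\<dots> = (\<Sum>k\<le>Suc b.
      of_nat (Suc b choose k) * monomial (xvar i j) ^ k * monomial v ^ (Suc b - k) * monomial w)"
    by (simp only: binomial_ring sum_distrib_right)
  also have "\<dots> = (\<Sum>k\<le>Suc b. Poly_Mapping.single (\<mu> k) (of_nat (Suc b choose k)))"
  proof (rule sum.cong[OF refl])
    fix k
    have "of_nat (Suc b choose k) = (const (of_nat (Suc b choose k)) :: 'k mpoly)"
      by (simp only: const_def single_of_nat)
    then show "of_nat (Suc b choose k) * monomial (xvar i j) ^ k * monomial v ^ (Suc b - k) * monomial w =
        (Poly_Mapping.single (\<mu> k) (of_nat (Suc b choose k)) :: 'k mpoly)"
      by (simp only: xvar_def monomial_single_power monomial_power[of v] \<mu>_def mult.assoc
          flip: monomial_add const_monomial)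
  qed
  finally have g: "g = (\<Sum>k\<le>Suc b. Poly_Mapping.single (\<mu> k) (of_nat (Suc b choose k)))" .
  have \<mu>_eq_iff: "\<mu> k = \<mu> b \<longleftrightarrow> k = b" for k
    using lookup_\<mu> by metis
  have "Poly_Mapping.lookup g (\<mu> b) = (\<Sum>k\<le>Suc b. if k = b then of_nat (Suc b choose k) else 0)"
    by (simp only: g lookup_sum lookup_single when_def \<mu>_eq_iff)
  also have "\<dots> = of_nat (Suc b)"
    by (subst sum.delta) (simp_all del: of_nat_Suc)
  finally have "Poly_Mapping.lookup g (\<mu> b) = of_nat (Suc b)" .
  then have "\<mu> b \<in> Poly_Mapping.keys g"
    by (simp add: in_keys_iff del: of_nat_Suc)
  then have "monomial (\<mu> b) \<in> I"
    by (rule T_fixed_monomials[OF ideal fixed \<open>g \<in> I\<close>])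
  moreover have "(v + u) - xvar i j = \<mu> b"
  proof -
    have "v + u = xvar i j + \<mu> b"
    proof -
      have "Poly_Mapping.single (i, j) (Suc b) = xvar i j + Poly_Mapping.single (i, j) b"
        by (simp add: xvar_def flip: single_add)
      then have "u = (xvar i j + Poly_Mapping.single (i, j) b) + w"
        using w(1) b by simp
      then show ?thesis by (simp add: \<mu>_def add.assoc add.left_commute)
    qed
    then show ?thesis by simp
  qed
  ultimately show ?thesis by simp
qed

lemma T_fixed_imp_strongly_stable:
  assumes ideal: "ideal I (mpoly_ring l n)" and fixed: "T_fixed n l q I"
  shows "strongly_stable n l q I"
  unfolding strongly_stable_def
proof (intro conjI ballI impI)
  show "monomial_ideal n l I"
    using T_fixed_monomials[OF ideal fixed] monomial_ideal_iff[OF ideal] by blast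
next
  fix u i j h
  assume "monomial u \<in> I" "i \<in> {1..n}" "j \<in> {1..l i}" "0 < Poly_Mapping.lookup u (i, j)" "h \<in> {1..<j}"
  then show "monomial ((xvar i h + u) - xvar i j) \<in> I"
    by (intro T_fixed_lower[OF ideal fixed]) (auto simp: vars_def lower_mons_def)
next
  fix u i j v
  assume "monomial u \<in> I" "i \<in> {1..n}" "j \<in> {1..l i}" "0 < Poly_Mapping.lookup u (i, j)"
    "v \<in> mons l (i - 1)" "mdeg q v = q i"
  then show "monomial ((v + u) - xvar i j) \<in> I"
    by (intro T_fixed_lower[OF ideal fixed]) (auto simp: vars_def lower_mons_def)
qed

theorem proposition1p5:
  fixes n :: nat and l q :: "nat \<Rightarrow> nat" and I :: "'k::field_char_0 mpoly set"
  assumes q_pos: "\<forall>i\<in>{1..n}. 0 < q i"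
    and q_mono: "strict_mono_on {1..n} q"
    and hom: "homogeneous_ideal n l q I"
  shows "T_fixed n l q I \<longleftrightarrow> strongly_stable n l q I"
  using hom T_fixed_imp_strongly_stable strongly_stable_imp_T_fixed
  unfolding homogeneous_ideal_def by blast

end
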